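(* Let $n\ge 1$ and $\varepsilon\in[0,1]$. Every Hermitian matrix $A\in\mathbb{C}^{n\times n}$ with $0\preceq A\preceq I$ and $\operatorname{tr}(A)\le(1-\varepsilon)n$ satisfies $$\operatorname{per}(A)\le\left(1-\frac{\varepsilon^2}{20}\right)^n .$$
   Context: $\operatorname{per}(A)=\sum_{\sigma\in S_n}\prod_{i=1}^n A_{i,\sigma(i)}$ is the permanent, and $\preceq$ denotes the Loewner order on Hermitian matrices. *)

theory Defs
  imports "HOL-Analysis.Analysis"
begin

definition permanent :: "'a::comm_semiring_1 ^ 'n ^ 'n \<Rightarrow> 'a" where
  "permanent A = (\<Sum>p | p permutes (UNIV :: 'n set). \<Prod>i\<in>UNIV. A $ i $ p i)"

definition conj_transpose :: "complex ^ 'n ^ 'm \<Rightarrow> complex ^ 'm ^ 'n" where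
  "conj_transpose A = map_matrix cnj (transpose A)"

definition hermitian :: "complex ^ 'n ^ 'n \<Rightarrow> bool" where
  "hermitian A \<longleftrightarrow> conj_transpose A = A"

text \<open>
  The sesquilinear product, conjugate-linear in the first argument. The library's
  \<open>\<bullet>\<close> on \<^typ>\<open>complex ^ 'n\<close> is only its real part.
\<close>

definition cinner_vec :: "complex ^ 'n \<Rightarrow> complex ^ 'n \<Rightarrow> complex" where
  "cinner_vec x y = (\<Sum>i\<in>UNIV. cnj (x $ i) * y $ i)"

definition pos_semidef :: "complex ^ 'n ^ 'n \<Rightarrow> bool" where
  "pos_semidef A \<longleftrightarrow> hermitian A \<and> (\<forall>x. cinner_vec x (A *v x) \<in> \<real>\<^sub>\<ge>\<^sub>0)"

text \<open>
  The Loewner order needs its own symbol: \<open>\<le>\<close> on the vector types is componentwise.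
\<close>

definition loewner_le :: "complex ^ 'n ^ 'n \<Rightarrow> complex ^ 'n ^ 'n \<Rightarrow> bool"  (infix "\<preceq>" 50) where
  "A \<preceq> B \<longleftrightarrow> pos_semidef (B - A)"

end

theory Submission
  imports Defs "HOL-Probability.Hoeffding"
begin

text \<open>
  Glynn's formula writes the permanent as the average of \<open>\<Prod>i. x\<^sub>i (A x)\<^sub>i\<close> over sign vectors \<open>x\<close>.
  Since \<open>\<bar>y\<bar> \<le> exp ((\<bar>y\<bar>\<^sup>2 - 1) / 2)\<close> and \<open>\<parallel>A x\<parallel>\<^sup>2 \<le> n\<close>, the permanent is at most the average of
  \<open>exp (\<theta> (\<parallel>A x\<parallel>\<^sup>2 - n) / 2)\<close> for every \<open>\<theta> \<in> {0..1}\<close>. The exponential moment of a quadratic form in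
  random signs is bounded by averaging out one sign at a time, using \<open>cosh u \<le> exp (u\<^sup>2 / 2)\<close>; each
  step replaces the form \<open>B\<close> by \<open>B' + b b\<^sup>T\<close>, which stays below \<open>\<theta>\<close> times the identity while the
  trace drops by a definite fraction of the removed diagonal entry. As \<open>tr (A\<^sup>2) \<le> tr A\<close>, the choice
  \<open>\<theta> = \<epsilon> / 2\<close> gives the bound \<open>exp (- \<epsilon>\<^sup>2 n / 8)\<close>.
\<close>

section \<open>Exponential moments of quadratic forms in random signs\<close>

text \<open>\<open>PiE\<close> pins the functions to \<open>undefined\<close> off \<open>S\<close>,
  so there are exactly 2^|S| of them and a sum over them is an unnormalised expectation.\<close>

abbreviation signs :: "'a set \<Rightarrow> ('a \<Rightarrow> real) set" where
  "signs S \<equiv> PiE S (\<lambda>_. {1, -1})"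

lemma sum_signs_insert:
  assumes "a \<notin> S"
  shows "(\<Sum>x\<in>signs (insert a S). f x) = (\<Sum>x\<in>signs S. f (x(a := 1)) + f (x(a := -1)))"
proof -
  have "(\<Sum>x\<in>signs (insert a S). f x) = (\<Sum>(s, x)\<in>{1, -1} \<times> signs S. f (x(a := s)))"
    unfolding PiE_insert_eq
    using inj_combinator[OF assms, of "\<lambda>_. {1, -1}"]
    by (subst sum.reindex) (auto simp: case_prod_unfold)
  also have "\<dots> = (\<Sum>s\<in>{1, -1}. \<Sum>x\<in>signs S. f (x(a := s)))"
    by (simp add: sum.cartesian_product)
  finally show ?thesis
    by (simp add: sum.distrib)
qed

lemma cosh_le_exp_half_square: "exp u + exp (- u) \<le> 2 * exp (u\<^sup>2 / 2)" for u :: real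
proof -
  have *: "exp u + exp (- u) \<le> 2 * exp (u\<^sup>2 / 2)" if "0 < u" for u :: real
  proof -
    \<comment> \<open>With step 2u and probability 1/2, the left side of Hoeffding's estimate is ln
      (cosh u) and its bound (2u)^2 / 8 is u^2 / 2.\<close>
    have "- u + ln ((1 + exp (2 * u)) / 2) \<le> u\<^sup>2 / 2"
      using Hoeffdings_lemma_aux[of "2 * u" "1 / 2"] that
      by (simp add: field_simps power2_eq_square)
    then have le: "exp (- u + ln ((1 + exp (2 * u)) / 2)) \<le> exp (u\<^sup>2 / 2)"
      by simp
    have "exp (ln ((1 + exp (2 * u)) / 2)) = (1 + exp (2 * u)) / 2"
      by (rule exp_ln) (simp add: add_pos_pos)
    then have "exp (- u + ln ((1 + exp (2 * u)) / 2)) = exp (- u) * ((1 + exp (2 * u)) / 2)"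
      by (simp only: exp_add)
    also have "exp (- u) * ((1 + exp (2 * u)) / 2) = (exp u + exp (- u)) / 2"
      by (simp add: algebra_simps add_divide_distrib flip: exp_add)
    finally have "(exp u + exp (- u)) / 2 \<le> exp (u\<^sup>2 / 2)"
      using le by (simp only:)
    then show ?thesis
      by simp
  qed
  show ?thesis
    using *[of u] *[of "- u"] by (cases u "0 :: real" rule: linorder_cases) (auto simp: add.commute)
qed

text \<open>The index set is a parameter and \<open>B\<close> a function, so that an induction can
  delete an index without changing the type.\<close>

definition quad_form :: "'a set \<Rightarrow> ('a \<Rightarrow> 'a \<Rightarrow> real) \<Rightarrow> ('a \<Rightarrow> real) \<Rightarrow> real" where
  "quad_form S B x = (\<Sum>i\<in>S. \<Sum>j\<in>S. B i j * x i * x j)"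

lemma quad_form_insert:
  assumes "finite S" "a \<notin> S" "\<And>i j. B i j = B j i"
  shows "quad_form (insert a S) B x
    = B a a * (x a)\<^sup>2 + 2 * x a * (\<Sum>i\<in>S. B a i * x i) + quad_form S B x"
proof -
  have "(\<Sum>i\<in>S. B i a * x i * x a) = x a * (\<Sum>i\<in>S. B a i * x i)"
    by (simp add: sum_distrib_left assms(3)[of _ a] mult_ac)
  moreover have "(\<Sum>i\<in>S. B a i * x a * x i) = x a * (\<Sum>i\<in>S. B a i * x i)"
    by (simp add: sum_distrib_left mult_ac)
  ultimately show ?thesis
    using assms(1,2) by (simp add: quad_form_def sum.distrib power2_eq_square)
qed

lemma quad_form_add_rank1:
  "quad_form S (\<lambda>i j. B i j + b i * b j) x = quad_form S B x + (\<Sum>i\<in>S. b i * x i)\<^sup>2"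
proof -
  have "(\<Sum>i\<in>S. b i * x i)\<^sup>2 = (\<Sum>i\<in>S. \<Sum>j\<in>S. b i * b j * x i * x j)"
    by (simp add: power2_eq_square sum_product mult_ac)
  then show ?thesis
    by (simp add: quad_form_def algebra_simps sum.distrib)
qed

lemma quad_form_cong: "(\<And>i. i \<in> S \<Longrightarrow> x i = y i) \<Longrightarrow> quad_form S B x = quad_form S B y"
  by (simp add: quad_form_def)

text \<open>Removing the index \<open>a\<close> costs a factor exp (\<open>B a a\<close> / 2), while
  its share of the bound is exp (\<open>B a a\<close> / (2 (1 - \<theta>))). The surplus pays for
  the rank-one update, which raises the remaining trace by at most \<theta>
  \<open>B a a\<close>.\<close>

lemma sum_signs_exp_quad_form_le:
  assumes "finite S" "\<And>i j. B i j = B j i" "0 \<le> \<theta>" "\<theta> < 1"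
    and "\<And>x. 0 \<le> quad_form S B x" "\<And>x. quad_form S B x \<le> \<theta> * (\<Sum>i\<in>S. (x i)\<^sup>2)"
  shows "(\<Sum>x\<in>signs S. exp (quad_form S B x / 2))
    \<le> 2 ^ card S * exp ((\<Sum>i\<in>S. B i i) / (2 * (1 - \<theta>)))"
  using assms(1,2,5,6)
proof (induction S arbitrary: B rule: finite_induct)
  case empty
  then show ?case by (simp add: quad_form_def)
next
  case (insert a S)
  define b where "b = (\<lambda>i. B a i)"
  define t where "t = (\<lambda>x. \<Sum>i\<in>S. b i * x i)"
  \<comment> \<open>Averaging exp (\<plusminus> \<open>t x\<close>) over the sign at
    \<open>a\<close> gives at most exp (\<open>(t x)\<close>^2 / 2), that is, the form on
    \<open>S\<close> gains the square of the linear form \<open>t\<close>.\<close>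
  define C where "C = (\<lambda>i j. B i j + b i * b j)"
  have a: "a \<notin> S" "finite S" using insert.hyps by auto
  have split: "quad_form (insert a S) B x = B a a * (x a)\<^sup>2 + 2 * x a * t x + quad_form S B x" for x
    using quad_form_insert[OF a(2,1) insert.prems(1)] by (simp add: t_def b_def)
  have C: "quad_form S C x = quad_form S B x + (t x)\<^sup>2" for x
    unfolding C_def t_def by (rule quad_form_add_rank1)
  have upd: "quad_form S B (x(a := s)) = quad_form S B x" "t (x(a := s)) = t x"
    "(\<Sum>i\<in>S. ((x(a := s)) i)\<^sup>2) = (\<Sum>i\<in>S. (x i)\<^sup>2)" for x s
    using a by (auto simp: t_def intro!: quad_form_cong sum.cong)
  have low: "0 \<le> B a a * s\<^sup>2 + 2 * s * t x + quad_form S B x" for s x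
    using insert.prems(2)[of "x(a := s)"] unfolding split upd by simp
  have high: "B a a * s\<^sup>2 + 2 * s * t x + quad_form S B x \<le> \<theta> * (s\<^sup>2 + (\<Sum>i\<in>S. (x i)\<^sup>2))" for s x
    using insert.prems(3)[of "x(a := s)"] a unfolding split upd sum.insert[OF a(2,1)] by simp
  have t0: "t (\<lambda>_. 0) = 0" and q0: "quad_form S B (\<lambda>_. 0) = 0"
    by (auto simp: t_def quad_form_def)
  have Baa: "0 \<le> B a a" using low[of 1 "\<lambda>_. 0"] by (simp add: t0 q0)
  have Cle: "quad_form S C x \<le> \<theta> * (\<Sum>i\<in>S. (x i)\<^sup>2)" for x
  proof -
    have "0 \<le> (1 + B a a - \<theta>) * (t x)\<^sup>2" using Baa \<open>\<theta> < 1\<close> by simp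
    \<comment> \<open>Putting the value \<open>t x\<close> at coordinate \<open>a\<close> turns the
      cross term into 2 \<open>(t x)\<close>^2: one copy completes \<open>C\<close>, the other
      absorbs the \<theta> \<open>(t x)\<close>^2 on the right.\<close>
    with high[of "t x" x] show ?thesis
      by (simp add: C algebra_simps power2_eq_square)
  qed
  have C0: "0 \<le> quad_form S C x" for x
    using low[of 0 x] by (simp add: C)
  have b2: "(\<Sum>i\<in>S. (b i)\<^sup>2) \<le> \<theta> * B a a"
  proof -
    define \<beta> where "\<beta> = (\<Sum>i\<in>S. (b i)\<^sup>2)"
    have tb: "t b = \<beta>" by (simp add: t_def \<beta>_def power2_eq_square)
    have \<beta>0: "0 \<le> \<beta>" by (simp add: \<beta>_def sum_nonneg)
    have up: "quad_form S B b \<le> \<theta> * \<beta>" using high[of 0 b] by (simp add: \<beta>_def)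
    have "0 \<le> B a a * s\<^sup>2 + 2 * s * \<beta> + \<theta> * \<beta>" for s
      using low[of s b] up tb by simp
    \<comment> \<open>The test vector is \<open>b\<close> on \<open>S\<close> with -\<theta> at
      \<open>a\<close>. This is a trace of B^2 \<le> \<theta> B, read at the diagonal entry
      \<open>a\<close>.\<close>
    from this[of "- \<theta>"] have "0 \<le> \<theta> * (\<theta> * B a a - \<beta>)"
      by (simp add: algebra_simps power2_eq_square)
    \<comment> \<open>For \<theta> = 0 the factor \<theta> cannot be cancelled. Then
      \<open>B a a\<close> = 0, and the value -1 at \<open>a\<close> leaves 0 \<le> -2
      \<beta>.\<close>
    moreover have "\<beta> \<le> 0" if "\<theta> = 0"
      using high[of 1 "\<lambda>_. 0"] low[of "-1" b] up tb Baa that by (simp add: t0 q0)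
    ultimately show ?thesis
      using \<open>0 \<le> \<theta>\<close> unfolding \<beta>_def[symmetric]
      by (cases "\<theta> = 0") (auto simp: zero_le_mult_iff)
  qed
  have IH: "(\<Sum>x\<in>signs S. exp (quad_form S C x / 2))
    \<le> 2 ^ card S * exp ((\<Sum>i\<in>S. C i i) / (2 * (1 - \<theta>)))"
  proof (rule insert.IH)
    show "C i j = C j i" for i j
      unfolding C_def by (subst insert.prems(1)) (rule arg_cong[OF mult.commute])
  qed (rule C0 Cle)+
  have step: "exp (quad_form (insert a S) B (x(a := 1)) / 2) + exp (quad_form (insert a S) B (x(a := -1)) / 2)
    \<le> 2 * exp (B a a / 2) * exp (quad_form S C x / 2)" for x
  proof -
    have "exp (quad_form (insert a S) B (x(a := 1)) / 2) + exp (quad_form (insert a S) B (x(a := -1)) / 2)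
      = exp (B a a / 2) * exp (quad_form S B x / 2) * (exp (t x) + exp (- t x))"
      unfolding split upd by (simp add: add_divide_distrib diff_divide_distrib algebra_simps flip: exp_add)
    also have "\<dots> \<le> exp (B a a / 2) * exp (quad_form S B x / 2) * (2 * exp ((t x)\<^sup>2 / 2))"
      by (intro mult_left_mono cosh_le_exp_half_square) auto
    also have "\<dots> = 2 * exp (B a a / 2) * exp (quad_form S C x / 2)"
      by (simp add: C add_divide_distrib exp_add)
    finally show ?thesis .
  qed
  have tr: "B a a / 2 + (\<Sum>i\<in>S. C i i) / (2 * (1 - \<theta>)) \<le> (\<Sum>i\<in>insert a S. B i i) / (2 * (1 - \<theta>))"
  proof -
    have "(\<Sum>i\<in>S. C i i) = (\<Sum>i\<in>S. B i i) + (\<Sum>i\<in>S. (b i)\<^sup>2)"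
      by (simp add: C_def sum.distrib power2_eq_square)
    then have "B a a * (1 - \<theta>) + (\<Sum>i\<in>S. C i i) \<le> (\<Sum>i\<in>insert a S. B i i)"
      using b2 a by (simp add: algebra_simps)
    then have "(B a a * (1 - \<theta>) + (\<Sum>i\<in>S. C i i)) / (2 * (1 - \<theta>)) \<le> (\<Sum>i\<in>insert a S. B i i) / (2 * (1 - \<theta>))"
      using \<open>\<theta> < 1\<close> by (intro divide_right_mono) auto
    moreover have "B a a * (1 - \<theta>) / (2 * (1 - \<theta>)) = B a a / 2"
      using \<open>\<theta> < 1\<close> by (simp add: divide_simps)
    ultimately show ?thesis
      unfolding add_divide_distrib by (simp only:)
  qed
  have "(\<Sum>x\<in>signs (insert a S). exp (quad_form (insert a S) B x / 2))
    \<le> (\<Sum>x\<in>signs S. 2 * exp (B a a / 2) * exp (quad_form S C x / 2))"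
    unfolding sum_signs_insert[OF a(1)] by (intro sum_mono step)
  also have "\<dots> \<le> 2 * exp (B a a / 2) * (2 ^ card S * exp ((\<Sum>i\<in>S. C i i) / (2 * (1 - \<theta>))))"
    unfolding sum_distrib_left[symmetric] by (intro mult_left_mono IH) auto
  also have "\<dots> = 2 ^ card (insert a S) * exp (B a a / 2 + (\<Sum>i\<in>S. C i i) / (2 * (1 - \<theta>)))"
    using a by (simp add: exp_add)
  also have "\<dots> \<le> 2 ^ card (insert a S) * exp ((\<Sum>i\<in>insert a S. B i i) / (2 * (1 - \<theta>)))"
    using tr by simp
  finally show ?case .
qed

section \<open>Glynn's formula\<close>

text \<open>Flipping the sign at \<open>j\<close> is a bijection of the sign vectors that negates
  every summand, since \<open>x j\<close> enters only once, through the factor with i = j.\<close>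

lemma sum_signs_prod_eq_0:
  fixes f :: "'n::finite \<Rightarrow> 'n"
  assumes "j \<notin> range f"
  shows "(\<Sum>x\<in>signs UNIV. \<Prod>i\<in>UNIV. x i * x (f i)) = 0"
proof -
  define T where "T = (\<lambda>x :: 'n \<Rightarrow> real. x(j := - x j))"
  have T: "bij_betw T (signs UNIV) (signs UNIV)"
    by (rule bij_betwI[of _ _ _ T]) (auto simp: T_def PiE_UNIV_domain Pi_iff)
  have "(\<Prod>i\<in>UNIV. T x i * T x (f i)) = - (\<Prod>i\<in>UNIV. x i * x (f i))" for x
  proof -
    have "T x (f i) = x (f i)" for i
      using assms by (auto simp: T_def)
    moreover have "(\<Prod>i\<in>UNIV. T x i) = - (\<Prod>i\<in>UNIV. x i)"
      using prod.remove[of UNIV j "T x"] prod.remove[of UNIV j x] by (simp add: T_def)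
    ultimately show ?thesis
      by (simp add: prod.distrib)
  qed
  then have "(\<Sum>x\<in>signs UNIV. \<Prod>i\<in>UNIV. x i * x (f i)) = - (\<Sum>x\<in>signs UNIV. \<Prod>i\<in>UNIV. x i * x (f i))"
    using sum.reindex_bij_betw[OF T, of "\<lambda>x. \<Prod>i\<in>UNIV. x i * x (f i)"] by (simp add: sum_negf)
  then show ?thesis by linarith
qed

lemma card_signs: "finite S \<Longrightarrow> card (signs S) = 2 ^ card S"
  by (simp add: card_PiE numeral_2_eq_2)

lemma sum_signs_prod_permutes:
  fixes p :: "'n::finite \<Rightarrow> 'n"
  assumes "p permutes UNIV"
  shows "(\<Sum>x\<in>signs UNIV. \<Prod>i\<in>UNIV. x i * x (p i)) = 2 ^ CARD('n)"
proof -
  have "(\<Prod>i\<in>UNIV. x i * x (p i)) = 1" if "x \<in> signs UNIV" for x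
  proof -
    have "(\<Prod>i\<in>UNIV. x i * x (p i)) = (\<Prod>i\<in>UNIV. x i) * (\<Prod>i\<in>UNIV. x (p i))"
      by (rule prod.distrib)
    also have "(\<Prod>i\<in>UNIV. x (p i)) = (\<Prod>i\<in>UNIV. x i)"
      using prod.permute[OF assms, of x] by (simp add: o_def)
    also have "(\<Prod>i\<in>UNIV. x i) * (\<Prod>i\<in>UNIV. x i) = (\<Prod>i\<in>UNIV. x i * x i)"
      by (rule prod.distrib[symmetric])
    also have "\<dots> = 1"
    proof (rule prod.neutral, rule ballI)
      show "x i * x i = 1" for i
        using PiE_mem[OF that, of i] by auto
    qed
    finally show ?thesis .
  qed
  then show ?thesis
    using card_signs[of "UNIV :: 'n set"] by simp
qed

text \<open>Expanding the product of row sums gives one term for each function \<open>f\<close>.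
  Averaging over signs kills those that miss a value and gives weight 1 to the permutations, in
  which every sign occurs twice.\<close>

lemma Glynn_formula:
  fixes A :: "complex ^ 'n ^ 'n"
  shows "2 ^ CARD('n) * permanent A
    = (\<Sum>x\<in>signs UNIV. \<Prod>i\<in>UNIV. of_real (x i) * (\<Sum>j\<in>UNIV. A $ i $ j * of_real (x j)))"
    (is "_ = ?R")
proof -
  have "?R = (\<Sum>x\<in>signs UNIV. \<Sum>f\<in>UNIV. (\<Prod>i\<in>UNIV. A $ i $ f i) * of_real (\<Prod>i\<in>UNIV. x i * x (f i)))"
    by (simp add: sum_distrib_left prod_sum_PiE prod.distrib mult_ac)
  also have "\<dots> = (\<Sum>f\<in>UNIV. (\<Prod>i\<in>UNIV. A $ i $ f i) * of_real (\<Sum>x\<in>signs UNIV. \<Prod>i\<in>UNIV. x i * x (f i)))"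
    by (subst sum.swap) (simp add: sum_distrib_left)
  also have "\<dots> = (\<Sum>p | p permutes (UNIV :: 'n set). (\<Prod>i\<in>UNIV. A $ i $ p i) * 2 ^ CARD('n))"
  proof (rule sum.mono_neutral_cong_right)
    show "\<forall>f\<in>UNIV - {p. p permutes UNIV}.
      (\<Prod>i\<in>UNIV. A $ i $ f i) * of_real (\<Sum>x\<in>signs UNIV. \<Prod>i\<in>UNIV. x i * x (f i)) = 0"
    proof
      fix f :: "'n \<Rightarrow> 'n" assume "f \<in> UNIV - {p. p permutes UNIV}"
      then have "\<not> surj f"
        using finite_UNIV_surj_inj[of f] by (auto intro: bij_imp_permutes simp: bij_def)
      then obtain j where "j \<notin> range f" by auto
      then show "(\<Prod>i\<in>UNIV. A $ i $ f i) * of_real (\<Sum>x\<in>signs UNIV. \<Prod>i\<in>UNIV. x i * x (f i)) = 0"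
        by (simp only: sum_signs_prod_eq_0) simp
    qed
  qed (auto simp only: sum_signs_prod_permutes mem_Collect_eq of_real_power of_real_numeral finite)
  finally show ?thesis
    by (simp add: permanent_def sum_distrib_left sum_distrib_right mult.commute)
qed

text \<open>Reindexing each product by \<open>p\<close> replaces \<open>p\<close> by its inverse,
  which only reorders the sum. For a Hermitian matrix this makes the permanent real.\<close>

lemma permanent_conj_transpose: "permanent (conj_transpose A) = cnj (permanent A)"
proof -
  have "(\<Prod>i\<in>UNIV. A $ p i $ i) = (\<Prod>i\<in>UNIV. A $ i $ inv p i)"
    if "p permutes UNIV" for p :: "'a \<Rightarrow> 'a"
    using prod.permute[OF that, of "\<lambda>i. A $ i $ inv p i"] that
    by (simp add: o_def permutes_inverses)
  then have "cnj (permanent (conj_transpose A)) = (\<Sum>p | p permutes UNIV. \<Prod>i\<in>UNIV. A $ i $ inv p i)"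
    by (simp add: permanent_def conj_transpose_def map_matrix_def transpose_def)
  also have "\<dots> = permanent A"
    unfolding permanent_def by (rule sum_permutations_inverse[symmetric])
  finally show ?thesis
    by (metis complex_cnj_cnj)
qed

section \<open>Contractions\<close>

lemma cinner_vec_diff_right: "cinner_vec x (y - z) = cinner_vec x y - cinner_vec x z"
  by (simp add: cinner_vec_def algebra_simps sum_subtractf)

lemma cinner_vec_diff_left: "cinner_vec (x - y) z = cinner_vec x z - cinner_vec y z"
  by (simp add: cinner_vec_def algebra_simps sum_subtractf)

lemma cinner_vec_self: "cinner_vec x x = of_real (\<Sum>i\<in>UNIV. (cmod (x $ i))\<^sup>2)"
  by (simp add: cinner_vec_def complex_norm_square mult.commute flip: of_real_power)

lemma cinner_vec_hermitian:
  assumes "hermitian A"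
  shows "cinner_vec (A *v x) y = cinner_vec x (A *v y)"
proof -
  have A: "cnj (A $ i $ j) = A $ j $ i" for i j
    using assms by (metis (no_types, lifting) conj_transpose_def hermitian_def map_matrix_def transpose_def vec_lambda_beta)
  have "cinner_vec (A *v x) y = (\<Sum>i\<in>UNIV. \<Sum>j\<in>UNIV. A $ j $ i * cnj (x $ j) * y $ i)"
    by (simp add: cinner_vec_def matrix_vector_mult_def sum_distrib_right A)
  also have "\<dots> = cinner_vec x (A *v y)"
    by (subst sum.swap) (simp add: cinner_vec_def matrix_vector_mult_def sum_distrib_left mult_ac)
  finally show ?thesis .
qed

context
  fixes A :: "complex ^ 'n ^ 'n"
  assumes herm: "hermitian A" and nonneg: "0 \<preceq> A" and le_1: "A \<preceq> mat 1"
begin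

lemma cinner_vec_nonneg: "0 \<le> Re (cinner_vec x (A *v x))"
  using nonneg by (auto simp: loewner_le_def pos_semidef_def complex_nonneg_Reals_iff)

lemma cinner_vec_le_self: "Re (cinner_vec x (A *v x)) \<le> Re (cinner_vec x x)"
proof -
  have "cinner_vec x ((mat 1 - A) *v x) \<in> \<real>\<^sub>\<ge>\<^sub>0"
    using le_1 by (simp add: loewner_le_def pos_semidef_def)
  then show ?thesis
    by (simp add: complex_nonneg_Reals_iff matrix_vector_mult_diff_rdistrib cinner_vec_diff_right)
qed

text \<open>\<open>A - A\<^sup>2 = A (1 - A) A + (1 - A) A (1 - A)\<close>\<close>
lemma norm_mult_le_cinner_vec: "Re (cinner_vec (A *v x) (A *v x)) \<le> Re (cinner_vec x (A *v x))"
  using cinner_vec_nonneg[of "x - A *v x"] cinner_vec_le_self[of "A *v x"]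
  by (simp add: matrix_vector_mult_diff_distrib cinner_vec_diff_left cinner_vec_diff_right
      cinner_vec_hermitian[OF herm])

text \<open>This is the contraction estimate at the j-th basis vector; summed over j it reads
  tr(A^2) \<le> tr(A).\<close>

lemma sum_norm_column_le: "(\<Sum>i\<in>UNIV. (cmod (A $ i $ j))\<^sup>2) \<le> Re (A $ j $ j)"
proof -
  have "cinner_vec (axis j 1) y = y $ j" for y :: "complex ^ 'n"
  proof -
    have "cnj (axis j 1 $ i) * y $ i = (if i = j then y $ i else 0)" for i
      by (simp add: axis_def)
    then show ?thesis
      by (simp add: cinner_vec_def)
  qed
  moreover have "(A *v axis j 1) $ i = A $ i $ j" for i
    by (simp add: matrix_vector_mult_def axis_def if_distrib cong: if_cong)
  ultimately show ?thesis
    using norm_mult_le_cinner_vec[of "axis j 1"] by (simp add: cinner_vec_self)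
qed

end

section \<open>The bound\<close>

lemma exp_minus_square_div_8_le: "exp (- (e\<^sup>2 / 8)) \<le> 1 - e\<^sup>2 / 20" if "0 \<le> e" "e \<le> 1" for e :: real
proof -
  have e: "e\<^sup>2 \<le> 1" "0 < 1 + e\<^sup>2 / 8"
    using that by (auto simp: power_le_one intro: add_pos_nonneg)
  have "exp (- (e\<^sup>2 / 8)) = 1 / exp (e\<^sup>2 / 8)"
    by (simp add: exp_minus field_simps)
  also have "\<dots> \<le> 1 / (1 + e\<^sup>2 / 8)"
    using exp_ge_add_one_self[of "e\<^sup>2 / 8"] e by (intro divide_left_mono mult_pos_pos) auto
  also have "\<dots> \<le> 1 - e\<^sup>2 / 20"
  proof -
    \<comment> \<open>This is 160 times the difference (1 - e^2/20)(1 + e^2/8) - 1.\<close>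
    have "0 \<le> e\<^sup>2 * (12 - e\<^sup>2)"
      using e by (intro mult_nonneg_nonneg) auto
    then have "1 \<le> (1 - e\<^sup>2 / 20) * (1 + e\<^sup>2 / 8)"
      by (simp add: algebra_simps)
    then show ?thesis
      using e by (simp add: divide_le_eq add_pos_nonneg)
  qed
  finally show ?thesis .
qed

text \<open>The square root of 1 + u \<le> exp u at u = |z|^2 - 1. It turns a product of moduli into
  an exponential of a squared norm.\<close>

lemma norm_le_exp_half: "cmod z \<le> exp (((cmod z)\<^sup>2 - 1) / 2)"
proof (rule power2_le_imp_le)
  have "(cmod z)\<^sup>2 \<le> exp ((cmod z)\<^sup>2 - 1)"
    using exp_ge_add_one_self[of "(cmod z)\<^sup>2 - 1"] by simp
  then show "(cmod z)\<^sup>2 \<le> (exp (((cmod z)\<^sup>2 - 1) / 2))\<^sup>2"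
    by (simp add: power2_eq_square flip: exp_add)
qed simp

lemma norm_permanent_le:
  fixes A :: "complex ^ 'n ^ 'n"
  assumes A: "hermitian A" "0 \<preceq> A" "A \<preceq> mat 1" and \<theta>: "0 \<le> \<theta>" "\<theta> < 1"
  shows "cmod (permanent A) \<le> exp (\<theta> / 2 * (Re (trace A) / (1 - \<theta>) - CARD('n)))"
proof -
  \<comment> \<open>The real part of \<theta> A^* A: on real vectors the antisymmetric imaginary
    part drops out, so the form is \<theta> |Ax|^2.\<close>
  define B where "B = (\<lambda>j k. \<theta> * Re (\<Sum>i\<in>UNIV. cnj (A $ i $ j) * A $ i $ k))"
  define y where "y = (\<lambda>x. A *v (\<chi> j. complex_of_real (x j)))"
  define N where "N = (\<lambda>x. \<Sum>i\<in>UNIV. (cmod (y x $ i))\<^sup>2)"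
  have y: "y x $ i = (\<Sum>j\<in>UNIV. A $ i $ j * of_real (x j))" for x i
    by (simp add: y_def matrix_vector_mult_def)
  have N_le: "N x \<le> (\<Sum>i\<in>UNIV. (x i)\<^sup>2)" for x
  proof -
    have "Re (cinner_vec (y x) (y x)) \<le> Re (cinner_vec (\<chi> j. of_real (x j)) (\<chi> j. of_real (x j)))"
      unfolding y_def using norm_mult_le_cinner_vec[OF A] cinner_vec_le_self[OF A] order_trans by blast
    then show ?thesis
      by (simp add: cinner_vec_self N_def)
  qed
  have N0: "0 \<le> N x" for x
    by (simp add: N_def sum_nonneg)
  have quad: "quad_form UNIV B x = \<theta> * N x" for x
  proof -
    have "of_real (N x) = cinner_vec (y x) (y x)"
      by (simp add: cinner_vec_self N_def)
    also have "\<dots> = (\<Sum>i\<in>UNIV. \<Sum>j\<in>UNIV. \<Sum>k\<in>UNIV. cnj (A $ i $ j) * A $ i $ k * of_real (x j * x k))"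
      unfolding cinner_vec_def y cnj_sum sum_product by (simp add: mult_ac)
    also have "\<dots> = (\<Sum>j\<in>UNIV. \<Sum>k\<in>UNIV. \<Sum>i\<in>UNIV. cnj (A $ i $ j) * A $ i $ k * of_real (x j * x k))"
      by (subst sum.swap) (intro sum.cong refl sum.swap)
    finally have "N x = (\<Sum>j\<in>UNIV. \<Sum>k\<in>UNIV. \<Sum>i\<in>UNIV. Re (cnj (A $ i $ j) * A $ i $ k * of_real (x j * x k)))"
      by (metis (no_types, lifting) Re_complex_of_real Re_sum sum.cong)
    also have "\<dots> = (\<Sum>j\<in>UNIV. \<Sum>k\<in>UNIV. Re (\<Sum>i\<in>UNIV. cnj (A $ i $ j) * A $ i $ k) * (x j * x k))"
      by (simp add: sum_distrib_right)
    finally show ?thesis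
      by (simp add: quad_form_def B_def sum_distrib_left mult_ac)
  qed
  have B_sym: "B j k = B k j" for j k
    by (simp add: B_def mult_ac)
  have B_trace: "(\<Sum>j\<in>UNIV. B j j) \<le> \<theta> * Re (trace A)"
  proof -
    have "(\<Sum>j\<in>UNIV. B j j) = \<theta> * (\<Sum>j\<in>UNIV. \<Sum>i\<in>UNIV. (cmod (A $ i $ j))\<^sup>2)"
      by (simp add: B_def sum_distrib_left cmod_power2 flip: power2_eq_square)
    also have "\<dots> \<le> \<theta> * (\<Sum>j\<in>UNIV. Re (A $ j $ j))"
      using \<theta> by (intro mult_left_mono sum_mono sum_norm_column_le[OF A])
    finally show ?thesis
      by (simp add: trace_def)
  qed
  have term_le: "cmod (\<Prod>i\<in>UNIV. of_real (x i) * y x $ i)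
      \<le> exp (quad_form UNIV B x / 2) * exp (- \<theta> * CARD('n) / 2)"
    if "x \<in> signs UNIV" for x :: "'n \<Rightarrow> real"
  proof -
    have x: "\<bar>x i\<bar> = 1" for i
      using that by (auto dest: PiE_mem[of x UNIV _ i])
    have "N x \<le> CARD('n)"
      using N_le[of x] x by (simp add: abs_square_eq_1[THEN iffD2])
    \<comment> \<open>The exponent is nonpositive, so damping it by \<theta> only weakens the bound,
      and it brings the form below \<theta> < 1, where the moment estimate applies.\<close>
    then have "N x - CARD('n) \<le> \<theta> * (N x - CARD('n))"
      using mult_right_mono_neg[of \<theta> 1 "N x - CARD('n)"] \<theta> by auto
    moreover have "cmod (\<Prod>i\<in>UNIV. of_real (x i) * y x $ i) = (\<Prod>i\<in>UNIV. cmod (y x $ i))"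
      by (simp add: norm_mult x prod_norm[symmetric])
    moreover have "\<dots> \<le> (\<Prod>i\<in>UNIV. exp (((cmod (y x $ i))\<^sup>2 - 1) / 2))"
      by (intro prod_mono) (auto simp: norm_le_exp_half)
    moreover have "\<dots> = exp ((N x - CARD('n)) / 2)"
      unfolding N_def
      by (subst exp_sum[symmetric]) (simp_all add: sum_subtractf sum_divide_distrib[symmetric])
    ultimately have "cmod (\<Prod>i\<in>UNIV. of_real (x i) * y x $ i) \<le> exp ((N x - CARD('n)) / 2)"
      and "exp ((N x - CARD('n)) / 2) \<le> exp (\<theta> * (N x - CARD('n)) / 2)"
      by simp_all
    then have "cmod (\<Prod>i\<in>UNIV. of_real (x i) * y x $ i) \<le> exp (\<theta> * (N x - CARD('n)) / 2)"
      by (rule order_trans)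
    then show ?thesis
      by (simp add: quad algebra_simps diff_divide_distrib flip: exp_add)
  qed
  have "2 ^ CARD('n) * cmod (permanent A) = cmod (\<Sum>x\<in>signs UNIV. \<Prod>i\<in>UNIV. of_real (x i) * y x $ i)"
    by (simp add: y norm_mult norm_power flip: Glynn_formula)
  also have "\<dots> \<le> (\<Sum>x\<in>signs UNIV. exp (quad_form UNIV B x / 2) * exp (- \<theta> * CARD('n) / 2))"
    by (intro sum_norm_le term_le)
  also have "\<dots> = (\<Sum>x\<in>signs UNIV. exp (quad_form UNIV B x / 2)) * exp (- \<theta> * CARD('n) / 2)"
    by (rule sum_distrib_right[symmetric])
  also have "\<dots> \<le> (2 ^ CARD('n) * exp ((\<Sum>j\<in>UNIV. B j j) / (2 * (1 - \<theta>)))) * exp (- \<theta> * CARD('n) / 2)"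
  proof (rule mult_right_mono[OF sum_signs_exp_quad_form_le])
    show "B j k = B k j" for j k
      by (rule B_sym)
    show "0 \<le> quad_form UNIV B x" "quad_form UNIV B x \<le> \<theta> * (\<Sum>i\<in>UNIV. (x i)\<^sup>2)" for x
      unfolding quad using \<theta> N0[of x] N_le[of x] by (auto intro: mult_left_mono)
  qed (use \<theta> in auto)
  also have "\<dots> \<le> (2 ^ CARD('n) * exp (\<theta> * Re (trace A) / (2 * (1 - \<theta>)))) * exp (- \<theta> * CARD('n) / 2)"
    using \<theta> B_trace by (intro mult_right_mono mult_left_mono) (auto intro: divide_right_mono)
  also have "\<dots> = 2 ^ CARD('n) * exp (\<theta> / 2 * (Re (trace A) / (1 - \<theta>) - CARD('n)))"
    by (simp add: algebra_simps flip: exp_add)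
  finally show ?thesis
    by simp
qed

theorem lemma1p3:
  fixes A :: "complex ^ 'n ^ 'n" and \<epsilon> :: real
  assumes "\<epsilon> \<in> {0..1}"
    and "hermitian A"
    and "0 \<preceq> A" and "A \<preceq> mat 1"
    and "Re (trace A) \<le> (1 - \<epsilon>) * real CARD('n)"
  shows "permanent A \<in> \<real> \<and> Re (permanent A) \<le> (1 - \<epsilon>\<^sup>2 / 20) ^ CARD('n)"
proof
  show "permanent A \<in> \<real>"
    using \<open>hermitian A\<close> by (metis Reals_cnj_iff hermitian_def permanent_conj_transpose)
  have \<epsilon>: "0 \<le> \<epsilon>" "\<epsilon> \<le> 1"
    using assms(1) by auto
  \<comment> \<open>With \<theta> = \<epsilon>/2 one has (1 - \<epsilon>)/(1 - \<theta>) - 1 =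
    -\<theta>/(1 - \<theta>) \<le> -\<epsilon>/2, and the prefactor \<theta>/2 = \<epsilon>/4 gives
    \<epsilon>^2/8.\<close>
  have "\<epsilon> / 2 / 2 * (Re (trace A) / (1 - \<epsilon> / 2) - CARD('n)) \<le> CARD('n) * - (\<epsilon>\<^sup>2 / 8)"
  proof -
    have "Re (trace A) / (1 - \<epsilon> / 2) - CARD('n) \<le> (1 - \<epsilon>) * CARD('n) / (1 - \<epsilon> / 2) - CARD('n)"
      using \<epsilon> assms(5) by (intro diff_right_mono divide_right_mono) auto
    also have "\<dots> = - (CARD('n) * (\<epsilon> / 2) / (1 - \<epsilon> / 2))"
      using \<epsilon> by (simp add: field_simps)
    also have "\<dots> \<le> - (CARD('n) * (\<epsilon> / 2))"
      using \<epsilon> by (simp add: le_divide_eq mult_left_mono)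
    finally have "\<epsilon> / 2 / 2 * (Re (trace A) / (1 - \<epsilon> / 2) - CARD('n)) \<le> \<epsilon> / 2 / 2 * - (CARD('n) * (\<epsilon> / 2))"
      using \<epsilon> by (intro mult_left_mono) auto
    then show ?thesis
      by (simp add: power2_eq_square mult_ac)
  qed
  then have "cmod (permanent A) \<le> exp (CARD('n) * - (\<epsilon>\<^sup>2 / 8))"
    using norm_permanent_le[OF assms(2-4), of "\<epsilon> / 2"] \<epsilon> by (auto elim!: order_trans)
  also have "\<dots> = exp (- (\<epsilon>\<^sup>2 / 8)) ^ CARD('n)"
    by (rule exp_of_nat_mult)
  also have "\<dots> \<le> (1 - \<epsilon>\<^sup>2 / 20) ^ CARD('n)"
    by (intro power_mono exp_minus_square_div_8_le \<epsilon>) simp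
  finally show "Re (permanent A) \<le> (1 - \<epsilon>\<^sup>2 / 20) ^ CARD('n)"
    using complex_Re_le_cmod order_trans by blast
qed

end
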